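(* Let $f\colon\Gamma\to\Delta$ be a covering of profinite graphs, written as $f=\varprojlim f_i$ for an inverse system $(f_i\colon\Gamma_i\to\Delta_i,\phi_{ij},\psi_{ij})$ of locally bijective maps of finite discrete graphs indexed by a directed set $I$, with canonical projections $\phi_i\colon\Gamma\to\Gamma_i$ and $\psi_i\colon\Delta\to\Delta_i$, where each $\psi_i$ is surjective. Put $S_i=\{(x,y)\in\Delta\times\Delta\mid \psi_i(x)=\psi_i(y)\}$ and identify $\Delta_i$ with $\Delta/S_i$. Let $\Sigma$ be a connected profinite graph, let $g\colon\Sigma\to\Delta$ be a continuous map of graphs, and let $a,b,c$ be vertices of $\Gamma,\Delta,\Sigma$ respectively such that $f(a)=b=g(c)$. Write $a_i=\phi_i(a)$ and $b_i=\psi_i(b)$. Then there exists a unique continuous map of graphs $h\colon\Sigma\to\Gamma$ such that $h(c)=a$ and $fh=g$ if and only if for each $i\in I$ there exists a compatible cofinite entourage $T_i$ of $\Sigma$ such that $(g\times g)[T_i]\subseteq S_i$ and $$(g_{S_iT_i})_*\,\pi_1(\Sigma/T_i,T_i[c])\subseteq (f_i)_*\,\pi_1(\Gamma_i,a_i),$$ where $g_{S_iT_i}\colon(\Sigma/T_i,T_i[c])\to(\Delta_i,b_i)$ is the natural map $T_i[x]\mapsto S_i[g(x)]=\psi_i(g(x))$.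
   Context: A graph $\Gamma$ is a set that is the disjoint union of a set $V(\Gamma)$ of vertices and a set $E(\Gamma)$ of edges, with maps $s,t\colon E(\Gamma)\to V(\Gamma)$ and an involution $e\mapsto\overline e$ of $E(\Gamma)$ such that $\overline e\ne e$, $s(\overline e)=t(e)$, $t(\overline e)=s(e)$. A map of graphs sends vertices to vertices and edges to edges and commutes with $s$, $t$ and $e\mapsto\overline e$. It is locally bijective if for every vertex $v$ it restricts to a bijection from $\{e\mid s(e)=v\}$ onto $\{e'\mid s(e')=f(v)\}$. A graph is path connected if it is nonempty and any two vertices are joined by a finite edge path. $\pi_1(\cdot,\cdot)$ is the ordinary fundamental group of an abstract graph at a vertex, and a lower star denotes the induced homomorphism. An equivalence relation $R$ on a graph $\Gamma$ is compatible if no vertex is equivalent to an edge, if $(e_1,e_2)\in R$ for edges implies $(s(e_1),s(e_2)),(t(e_1),t(e_2)),(\overline{e_1},\overline{e_2})\in R$, and $(e,\overline e)\notin R$ for all edges $e$; thus the set $\Gamma/R$ of classes $R[x]$ is a graph. A cofinite graph is a graph with a Hausdorff uniformity in which every entourage contains a compatible cofinite entourage, i.e. an entourage that is a compatible equivalence relation with finitely many classes. A profinite graph is a compact cofinite graph (equivalently, an inverse limit of finite discrete graphs). It is connected if $\Gamma/R$ is path connected for every compatible cofinite entourage $R$. An inverse system of maps $(f_i\colon\Gamma_i\to\Delta_i,\phi_{ij},\psi_{ij})$ over a directed set $I$ consists of continuous maps of graphs $f_i$, and, for $j\ge i$, continuous maps of graphs $\phi_{ij}\colon\Gamma_j\to\Gamma_i$,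 $\psi_{ij}\colon\Delta_j\to\Delta_i$ forming inverse systems, with $f_i\phi_{ij}=\psi_{ij}f_j$. Its inverse limit is the induced continuous map of graphs $f\colon\Gamma=\varprojlim\Gamma_i\to\Delta=\varprojlim\Delta_i$ (so $\psi_if=f_i\phi_i$ for the canonical projections). A continuous map of profinite graphs $f\colon\Gamma\to\Delta$ is a covering if it is the inverse limit of an inverse system of locally bijective maps of finite discrete graphs. *)

theory Defs
  imports "HOL-Analysis.Analysis" "HOL-Algebra.Group"
begin

section \<open>Abstract graphs\<close>

text \<open>
  Vertices and edges are points of one common type.  The values of the structure maps outside
  the set of edges carry no meaning.
\<close>

record 'a graph =
  verts :: "'a set"
  edges :: "'a set"
  src :: "'a \<Rightarrow> 'a"
  tgt :: "'a \<Rightarrow> 'a"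
  bar :: "'a \<Rightarrow> 'a"

definition points :: "'a graph \<Rightarrow> 'a set" where
  "points G = verts G \<union> edges G"

definition is_graph :: "'a graph \<Rightarrow> bool" where
  "is_graph G \<longleftrightarrow>
     verts G \<inter> edges G = {} \<and>
     (\<forall>e\<in>edges G. src G e \<in> verts G \<and> tgt G e \<in> verts G \<and> bar G e \<in> edges G \<and>
        bar G (bar G e) = e \<and> bar G e \<noteq> e \<and>
        src G (bar G e) = tgt G e \<and> tgt G (bar G e) = src G e)"

definition graph_map :: "'a graph \<Rightarrow> 'b graph \<Rightarrow> ('a \<Rightarrow> 'b) \<Rightarrow> bool" where
  "graph_map G H f \<longleftrightarrow>
     f ` verts G \<subseteq> verts H \<and> f ` edges G \<subseteq> edges H \<and>
     (\<forall>e\<in>edges G. f (src G e) = src H (f e) \<and> f (tgt G e) = tgt H (f e) \<and>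
        f (bar G e) = bar H (f e))"

definition locally_bijective :: "'a graph \<Rightarrow> 'b graph \<Rightarrow> ('a \<Rightarrow> 'b) \<Rightarrow> bool" where
  "locally_bijective G H f \<longleftrightarrow>
     graph_map G H f \<and>
     (\<forall>v\<in>verts G. bij_betw f {e \<in> edges G. src G e = v} {e \<in> edges H. src H e = f v})"

fun edge_path :: "'a graph \<Rightarrow> 'a \<Rightarrow> 'a list \<Rightarrow> 'a \<Rightarrow> bool" where
  "edge_path G u [] v \<longleftrightarrow> u \<in> verts G \<and> u = v"
| "edge_path G u (e # p) v \<longleftrightarrow> e \<in> edges G \<and> src G e = u \<and> edge_path G (tgt G e) p v"

definition graph_path_connected :: "'a graph \<Rightarrow> bool" where
  "graph_path_connected G \<longleftrightarrow>
     points G \<noteq> {} \<and> (\<forall>u\<in>verts G. \<forall>v\<in>verts G. \<exists>p. edge_path G u p v)"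


section \<open>The fundamental group of an abstract graph\<close>

definition loops :: "'a graph \<Rightarrow> 'a \<Rightarrow> 'a list set" where
  "loops G v = {p. edge_path G v p v}"

text \<open>
  Homotopy of loops is the equivalence relation generated by deleting a backtrack.
\<close>

definition backtrack :: "'a graph \<Rightarrow> 'a \<Rightarrow> ('a list \<times> 'a list) set" where
  "backtrack G v = {(p @ [e, bar G e] @ q, p @ q) | p e q. p @ [e, bar G e] @ q \<in> loops G v}"

definition homotopy :: "'a graph \<Rightarrow> 'a \<Rightarrow> ('a list \<times> 'a list) set" where
  "homotopy G v = (backtrack G v \<union> (backtrack G v)\<inverse>)\<^sup>* \<inter> loops G v \<times> loops G v"

definition pi1 :: "'a graph \<Rightarrow> 'a \<Rightarrow> 'a list set monoid" where
  "pi1 G v =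
     \<lparr>carrier = loops G v // homotopy G v,
      mult = (\<lambda>A B. homotopy G v `` {p @ q | p q. p \<in> A \<and> q \<in> B}),
      one = homotopy G v `` {[]}\<rparr>"

text \<open>
  The homomorphism \<open>pi1 G v \<rightarrow> pi1 H w\<close> induced by a map of graphs \<open>f\<close> from \<open>G\<close> to \<open>H\<close>
  with \<open>f v = w\<close>; it sends the class of a loop \<open>p\<close> to the class of \<open>map f p\<close>.
\<close>

definition pi1_map :: "'b graph \<Rightarrow> 'b \<Rightarrow> ('a \<Rightarrow> 'b) \<Rightarrow> 'a list set \<Rightarrow> 'b list set" where
  "pi1_map H w f A = homotopy H w `` (map f ` A)"


section \<open>Compatible equivalence relations and quotient graphs\<close>

definition compatible :: "'a graph \<Rightarrow> ('a \<times> 'a) set \<Rightarrow> bool" where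
  "compatible G R \<longleftrightarrow>
     equiv (points G) R \<and>
     (\<forall>v\<in>verts G. \<forall>e\<in>edges G. (v, e) \<notin> R) \<and>
     (\<forall>e1\<in>edges G. \<forall>e2\<in>edges G. (e1, e2) \<in> R \<longrightarrow>
        (src G e1, src G e2) \<in> R \<and> (tgt G e1, tgt G e2) \<in> R \<and> (bar G e1, bar G e2) \<in> R) \<and>
     (\<forall>e\<in>edges G. (e, bar G e) \<notin> R)"

text \<open>
  For a compatible \<open>R\<close> and an edge \<open>e\<close>, the set \<open>R `` (src G ` (R `` {e}))\<close> is the
  single class \<open>R `` {src G e}\<close>.
\<close>

definition quotient_graph :: "'a graph \<Rightarrow> ('a \<times> 'a) set \<Rightarrow> 'a set graph" where
  "quotient_graph G R =
     \<lparr>verts = verts G // R,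
      edges = edges G // R,
      src = (\<lambda>C. R `` (src G ` C)),
      tgt = (\<lambda>C. R `` (tgt G ` C)),
      bar = (\<lambda>C. R `` (bar G ` C))\<rparr>"

text \<open>
  The map \<open>R `` {x} \<mapsto> k x\<close> on classes, for \<open>k\<close> constant on the classes of \<open>R\<close>.
\<close>

definition class_map :: "('a \<Rightarrow> 'b) \<Rightarrow> 'a set \<Rightarrow> 'b" where
  "class_map k C = the_elem (k ` C)"


section \<open>Cofinite and profinite graphs\<close>

text \<open>
  The underlying uniform space of a cofinite graph is an entire type; that its uniformity is
  Hausdorff is the sort constraint \<open>t2_space\<close>.
\<close>

definition entourage :: "('a::uniform_space \<times> 'a) set \<Rightarrow> bool" where
  "entourage U \<longleftrightarrow> eventually (\<lambda>p. p \<in> U) uniformity"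

definition compatible_cofinite_entourage ::
    "'a::uniform_space graph \<Rightarrow> ('a \<times> 'a) set \<Rightarrow> bool" where
  "compatible_cofinite_entourage G R \<longleftrightarrow>
     entourage R \<and> compatible G R \<and> finite (points G // R)"

definition cofinite_graph :: "'a::{uniform_space, t2_space} graph \<Rightarrow> bool" where
  "cofinite_graph G \<longleftrightarrow>
     is_graph G \<and> points G = UNIV \<and>
     (\<forall>U. entourage U \<longrightarrow> (\<exists>R. compatible_cofinite_entourage G R \<and> R \<subseteq> U))"

definition profinite_graph :: "'a::{uniform_space, t2_space} graph \<Rightarrow> bool" where
  "profinite_graph G \<longleftrightarrow> cofinite_graph G \<and> compact (UNIV :: 'a set)"

definition connected_profinite_graph :: "'a::{uniform_space, t2_space} graph \<Rightarrow> bool" where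
  "connected_profinite_graph G \<longleftrightarrow>
     profinite_graph G \<and>
     (\<forall>R. compatible_cofinite_entourage G R \<longrightarrow> graph_path_connected (quotient_graph G R))"


section \<open>Inverse limits of finite discrete graphs\<close>

definition directed :: "'i set \<Rightarrow> ('i \<Rightarrow> 'i \<Rightarrow> bool) \<Rightarrow> bool" where
  "directed I leq \<longleftrightarrow>
     I \<noteq> {} \<and>
     (\<forall>i\<in>I. leq i i) \<and>
     (\<forall>i\<in>I. \<forall>j\<in>I. \<forall>k\<in>I. leq i j \<and> leq j k \<longrightarrow> leq i k) \<and>
     (\<forall>i\<in>I. \<forall>j\<in>I. \<exists>k\<in>I. leq i k \<and> leq j k)"

text \<open>
  The bonding map from stage \<open>j\<close> to stage \<open>i\<close> is \<open>\<phi> i j\<close>.  As each stage is discrete,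
  the bonding maps are continuous automatically.
\<close>

definition inverse_system ::
    "'i set \<Rightarrow> ('i \<Rightarrow> 'i \<Rightarrow> bool) \<Rightarrow> ('i \<Rightarrow> 'b graph) \<Rightarrow> ('i \<Rightarrow> 'i \<Rightarrow> 'b \<Rightarrow> 'b) \<Rightarrow> bool" where
  "inverse_system I leq X \<phi> \<longleftrightarrow>
     directed I leq \<and>
     (\<forall>i\<in>I. is_graph (X i) \<and> finite (points (X i))) \<and>
     (\<forall>i\<in>I. \<forall>j\<in>I. leq i j \<longrightarrow> graph_map (X j) (X i) (\<phi> i j)) \<and>
     (\<forall>i\<in>I. \<forall>x\<in>points (X i). \<phi> i i x = x) \<and>
     (\<forall>i\<in>I. \<forall>j\<in>I. \<forall>k\<in>I. leq i j \<and> leq j k \<longrightarrow>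
        (\<forall>x\<in>points (X k). \<phi> i j (\<phi> j k x) = \<phi> i k x))"

definition threads ::
    "'i set \<Rightarrow> ('i \<Rightarrow> 'i \<Rightarrow> bool) \<Rightarrow> ('i \<Rightarrow> 'b graph) \<Rightarrow> ('i \<Rightarrow> 'i \<Rightarrow> 'b \<Rightarrow> 'b) \<Rightarrow> ('i \<Rightarrow> 'b) set" where
  "threads I leq X \<phi> =
     {z \<in> \<Pi>\<^sub>E i\<in>I. points (X i). \<forall>i\<in>I. \<forall>j\<in>I. leq i j \<longrightarrow> \<phi> i j (z j) = z i}"

text \<open>
  \<open>G\<close> with the projections \<open>p i\<close> is the inverse limit: \<open>x \<mapsto> (p i x)\<^sub>i\<close> is a homeomorphism
  onto the space of threads.  Since the \<open>p i\<close> are maps of graphs, it is then also an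
  isomorphism of graphs onto the graph of threads, whose structure maps are componentwise.
\<close>

definition is_inverse_limit ::
    "'a::topological_space graph \<Rightarrow> 'i set \<Rightarrow> ('i \<Rightarrow> 'i \<Rightarrow> bool) \<Rightarrow> ('i \<Rightarrow> 'b graph) \<Rightarrow>
     ('i \<Rightarrow> 'i \<Rightarrow> 'b \<Rightarrow> 'b) \<Rightarrow> ('i \<Rightarrow> 'a \<Rightarrow> 'b) \<Rightarrow> bool" where
  "is_inverse_limit G I leq X \<phi> p \<longleftrightarrow>
     (\<forall>i\<in>I. graph_map G (X i) (p i)) \<and>
     homeomorphic_map
       (top_of_set (points G))
       (subtopology (product_topology (\<lambda>i. discrete_topology (points (X i))) I)
          (threads I leq X \<phi>))
       (\<lambda>x. \<lambda>i\<in>I. p i x)"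

text \<open>
  An inverse system of locally bijective maps \<open>f i : X i \<rightarrow> Y i\<close> of finite discrete graphs.
\<close>

definition locally_bijective_system ::
    "'i set \<Rightarrow> ('i \<Rightarrow> 'i \<Rightarrow> bool) \<Rightarrow> ('i \<Rightarrow> 'b graph) \<Rightarrow> ('i \<Rightarrow> 'c graph) \<Rightarrow>
     ('i \<Rightarrow> 'b \<Rightarrow> 'c) \<Rightarrow> ('i \<Rightarrow> 'i \<Rightarrow> 'b \<Rightarrow> 'b) \<Rightarrow> ('i \<Rightarrow> 'i \<Rightarrow> 'c \<Rightarrow> 'c) \<Rightarrow> bool" where
  "locally_bijective_system I leq X Y f \<phi> \<psi> \<longleftrightarrow>
     inverse_system I leq X \<phi> \<and> inverse_system I leq Y \<psi> \<and>
     (\<forall>i\<in>I. locally_bijective (X i) (Y i) (f i)) \<and>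
     (\<forall>i\<in>I. \<forall>j\<in>I. leq i j \<longrightarrow> (\<forall>x\<in>points (X j). f i (\<phi> i j x) = \<psi> i j (f j x)))"

text \<open>
  The continuous map of graphs \<open>f : G \<rightarrow> H\<close> is the inverse limit of such a system, with
  canonical projections \<open>p i\<close> and \<open>q i\<close>, so that it is a covering.
\<close>

definition covering_limit ::
    "'a::{uniform_space, t2_space} graph \<Rightarrow> 'b::{uniform_space, t2_space} graph \<Rightarrow> ('a \<Rightarrow> 'b) \<Rightarrow>
     'i set \<Rightarrow> ('i \<Rightarrow> 'i \<Rightarrow> bool) \<Rightarrow> ('i \<Rightarrow> 'c graph) \<Rightarrow> ('i \<Rightarrow> 'd graph) \<Rightarrow> ('i \<Rightarrow> 'c \<Rightarrow> 'd) \<Rightarrow>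
     ('i \<Rightarrow> 'i \<Rightarrow> 'c \<Rightarrow> 'c) \<Rightarrow> ('i \<Rightarrow> 'i \<Rightarrow> 'd \<Rightarrow> 'd) \<Rightarrow>
     ('i \<Rightarrow> 'a \<Rightarrow> 'c) \<Rightarrow> ('i \<Rightarrow> 'b \<Rightarrow> 'd) \<Rightarrow> bool" where
  "covering_limit G H f I leq X Y fs \<phi> \<psi> p q \<longleftrightarrow>
     profinite_graph G \<and> profinite_graph H \<and> graph_map G H f \<and> continuous_on UNIV f \<and>
     locally_bijective_system I leq X Y fs \<phi> \<psi> \<and>
     is_inverse_limit G I leq X \<phi> p \<and> is_inverse_limit H I leq Y \<psi> q \<and>
     (\<forall>i\<in>I. \<forall>x\<in>points G. q i (f x) = fs i (p i x))"

end

theory Submission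
  imports Defs
begin

text \<open>
  Edge paths lift uniquely along a locally bijective map, and the end of the lift does not change
  when a backtrack is deleted. Hence the condition on fundamental groups says exactly that the map
  from the quotient of \<open>\<Sigma>\<close> by \<open>T\<^sub>i\<close> to \<open>\<Delta>\<^sub>i\<close> lifts to \<open>\<Gamma>\<^sub>i\<close>, and on \<open>\<Sigma>\<close> this gives a map
  \<open>h\<^sub>i\<close> constant on the classes of \<open>T\<^sub>i\<close>. As the quotient of \<open>\<Sigma>\<close> by \<open>T\<^sub>i \<inter> T\<^sub>j\<close> is path connected,
  lifts are unique and the \<open>h\<^sub>i\<close> form a thread, so they define \<open>h\<close>. Conversely, for a lift \<open>h\<close>
  the kernel of \<open>\<phi>\<^sub>i \<circ> h\<close> serves as \<open>T\<^sub>i\<close>.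
\<close>

section \<open>Graphs, graph maps and edge paths\<close>

lemma is_graphD:
  assumes "is_graph G" "e \<in> edges G"
  shows "src G e \<in> verts G" "tgt G e \<in> verts G" "bar G e \<in> edges G" "bar G (bar G e) = e"
    "bar G e \<noteq> e" "src G (bar G e) = tgt G e" "tgt G (bar G e) = src G e"
  using assms unfolding is_graph_def by blast+

lemma is_graph_disjoint: "is_graph G \<Longrightarrow> x \<in> verts G \<Longrightarrow> x \<notin> edges G"
  unfolding is_graph_def by blast

lemma graph_mapD:
  assumes "graph_map G H f"
  shows "v \<in> verts G \<Longrightarrow> f v \<in> verts H" "e \<in> edges G \<Longrightarrow> f e \<in> edges H"
    "e \<in> edges G \<Longrightarrow> f (src G e) = src H (f e)" "e \<in> edges G \<Longrightarrow> f (tgt G e) = tgt H (f e)"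
    "e \<in> edges G \<Longrightarrow> f (bar G e) = bar H (f e)" "x \<in> points G \<Longrightarrow> f x \<in> points H"
  using assms unfolding graph_map_def points_def by blast+

lemma graph_map_comp:
  assumes "graph_map G H f" "graph_map H K g"
  shows "graph_map G K (g \<circ> f)"
  using assms unfolding graph_map_def by (auto simp: image_subset_iff)

lemma edge_path_verts:
  assumes "is_graph G" "edge_path G u p v"
  shows "u \<in> verts G \<and> v \<in> verts G"
  using assms(2) by (induction p arbitrary: u) (auto dest: is_graphD[OF assms(1)])

lemma edge_path_append:
  assumes "is_graph G"
  shows "edge_path G u (p @ q) w \<longleftrightarrow> (\<exists>v. edge_path G u p v \<and> edge_path G v q w)"
  by (induction p arbitrary: u) (auto dest: edge_path_verts[OF assms])

lemma edge_path_map: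
  assumes "graph_map G H f" "edge_path G u p v"
  shows "edge_path H (f u) (map f p) (f v)"
  using assms(2)
proof (induction p arbitrary: u)
  case (Cons e p)
  then have "edge_path H (f (tgt G e)) (map f p) (f v)" by simp
  then show ?case using Cons.prems graph_mapD(2-4)[OF assms(1), of e] by auto
qed (auto simp: graph_mapD[OF assms(1)])

lemma edge_path_rev:
  assumes "is_graph G" "edge_path G u p v"
  shows "edge_path G v (rev (map (bar G) p)) u"
  using assms(2)
  by (induction p arbitrary: u)
    (auto simp: edge_path_append[OF assms(1)] is_graphD[OF assms(1)])

lemma edge_path_edges: "edge_path G u p v \<Longrightarrow> set p \<subseteq> edges G"
  by (induction p arbitrary: u) auto

lemma edge_path_end_unique: "edge_path G u p v \<Longrightarrow> edge_path G u p v' \<Longrightarrow> v = v'"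
  by (induction p arbitrary: u) auto

lemma map_rev_path:
  assumes "graph_map G H f" "set p \<subseteq> edges G"
  shows "map f (rev (map (bar G) p)) = rev (map (bar H) (map f p))"
  using assms(2) by (induction p) (auto simp: graph_mapD[OF assms(1)])

lemma rev_path_rev_path:
  assumes "is_graph G" "set p \<subseteq> edges G"
  shows "rev (map (bar G) (rev (map (bar G) p))) = p"
  using assms(2) by (induction p) (auto simp: is_graphD[OF assms(1)])


section \<open>Homotopy of loops\<close>

lemma equiv_homotopy: "equiv (loops G v) (homotopy G v)"
proof (rule equivI)
  show "sym (homotopy G v)"
    unfolding homotopy_def
    by (intro sym_Int sym_rtrancl sym_Un_converse) (auto simp: sym_def)
  show "trans (homotopy G v)"
    unfolding homotopy_def
    by (intro trans_Int trans_rtrancl) (auto simp: trans_def)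
qed (auto simp: homotopy_def refl_on_def)

text \<open>A graph map commutes with \<open>bar\<close>, so it carries each backtrack to a
  backtrack; induction along a chain of insertions and deletions does the rest.\<close>

lemma homotopy_map:
  assumes f: "graph_map G H f" and pq: "(p, q) \<in> homotopy G v"
  shows "(map f p, map f q) \<in> homotopy H (f v)"
proof -
  have bt: "(map f p, map f q) \<in> backtrack H (f v)" if pq: "(p, q) \<in> backtrack G v" for p q
  proof -
    obtain r e s where eq: "p = r @ [e, bar G e] @ s" "q = r @ s"
      and l: "r @ [e, bar G e] @ s \<in> loops G v"
      using pq unfolding backtrack_def by blast
    have "e \<in> edges G" using edge_path_edges[of G v _ v, OF l[unfolded loops_def mem_Collect_eq]] by simp
    then have "map f p = map f r @ [f e, bar H (f e)] @ map f s"
      using graph_mapD[OF f] eq by simp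
    moreover have "map f p \<in> loops H (f v)"
      using l edge_path_map[OF f] eq unfolding loops_def by blast
    ultimately show ?thesis unfolding backtrack_def using eq by fastforce
  qed
  have "(map f p, map f q) \<in> (backtrack H (f v) \<union> (backtrack H (f v))\<inverse>)\<^sup>*"
    if "(p, q) \<in> (backtrack G v \<union> (backtrack G v)\<inverse>)\<^sup>*"
    using that by (induction rule: rtrancl_induct) (auto dest: bt intro: rtrancl_into_rtrancl)
  moreover have "map f r \<in> loops H (f v)" if "r \<in> loops G v" for r
    using that edge_path_map[OF f] unfolding loops_def by blast
  ultimately show ?thesis using pq unfolding homotopy_def by blast
qed

text \<open>By \<open>homotopy_map\<close> all images of members of the class are homotopic to
  \<open>map f p\<close>, so the induced map can be computed on one representative.\<close>

lemma pi1_map_class: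
  assumes f: "graph_map G H f" and p: "p \<in> loops G v"
  shows "pi1_map H (f v) f (homotopy G v `` {p}) = homotopy H (f v) `` {map f p}"
proof
  note E = equiv_homotopy[of H "f v"]
  show "pi1_map H (f v) f (homotopy G v `` {p}) \<subseteq> homotopy H (f v) `` {map f p}"
    using homotopy_map[OF f] E unfolding pi1_map_def equiv_def trans_def by blast
  have "(p, p) \<in> homotopy G v"
    using equiv_homotopy[of G v] p by (auto simp: equiv_def refl_on_def)
  then show "homotopy H (f v) `` {map f p} \<subseteq> pi1_map H (f v) f (homotopy G v `` {p})"
    unfolding pi1_map_def by blast
qed


section \<open>Lifting along locally bijective maps\<close>

lemma locally_bijective_graph_map: "locally_bijective X Y F \<Longrightarrow> graph_map X Y F"
  unfolding locally_bijective_def by blast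

text \<open>The injective half of local bijectivity; the surjective half follows. Applied edge by
  edge, they give unique lifting of paths.\<close>

lemma lift_edge_unique:
  assumes "locally_bijective X Y F" "is_graph X"
    and "e \<in> edges X" "e' \<in> edges X" "src X e = src X e'" "F e = F e'"
  shows "e = e'"
proof -
  have "inj_on F {d \<in> edges X. src X d = src X e}"
    using assms is_graphD(1)[OF assms(2,3)] unfolding locally_bijective_def bij_betw_def by blast
  then show ?thesis using assms by (auto dest: inj_onD)
qed

lemma lift_edge_exists:
  assumes "locally_bijective X Y F" "u \<in> verts X" "e \<in> edges Y" "src Y e = F u"
  shows "\<exists>d\<in>edges X. src X d = u \<and> F d = e"
proof -
  have "F ` {d \<in> edges X. src X d = u} = {e \<in> edges Y. src Y e = F u}"
    using assms unfolding locally_bijective_def bij_betw_def by blast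
  moreover have "e \<in> {e \<in> edges Y. src Y e = F u}" using assms by simp
  ultimately show ?thesis by (smt (verit) imageE mem_Collect_eq)
qed

lemma lift_path_unique:
  assumes F: "locally_bijective X Y F" and X: "is_graph X"
    and "edge_path X u q v" "edge_path X u q' v'" "map F q = map F q'"
  shows "q = q' \<and> v = v'"
  using assms(3-)
proof (induction q arbitrary: u q')
  case Nil
  then show ?case by simp
next
  case (Cons d q)
  then obtain d' r where q': "q' = d' # r" by (cases q') auto
  have "d = d'" using lift_edge_unique[OF F X, of d d'] Cons.prems q' by simp
  then show ?case using Cons.IH[of "tgt X d" r] Cons.prems q' by simp
qed

lemma lift_path_exists:
  assumes F: "locally_bijective X Y F" and X: "is_graph X"
    and "u \<in> verts X" "edge_path Y (F u) p w"
  shows "\<exists>q v. edge_path X u q v \<and> map F q = p"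
  using assms(3-)
proof (induction p arbitrary: u)
  case Nil
  then show ?case by (intro exI[of _ "[]"]) auto
next
  case (Cons e p)
  then obtain d where d: "d \<in> edges X" "src X d = u" "F d = e"
    using lift_edge_exists[OF F] by (metis edge_path.simps(2))
  have "edge_path Y (F (tgt X d)) p w"
    using Cons.prems d graph_mapD(4)[OF locally_bijective_graph_map[OF F]] by auto
  with Cons.IH[of "tgt X d"] is_graphD[OF X d(1)] obtain q v
    where "edge_path X (tgt X d) q v" "map F q = p" by blast
  then show ?case using d by (intro exI[of _ "d # q"] exI[of _ v]) auto
qed

text \<open>The monodromy of \<open>F\<close>, kept as a relation between the start and the end of a
  lift. No lift has to be chosen, and concatenation of paths becomes composition of
  relations.\<close>

definition lifts_to :: "'a graph \<Rightarrow> ('a \<Rightarrow> 'b) \<Rightarrow> 'a \<Rightarrow> 'b list \<Rightarrow> 'a \<Rightarrow> bool" where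
  "lifts_to X F u p v \<longleftrightarrow> (\<exists>q. edge_path X u q v \<and> map F q = p)"

lemma lifts_to_append:
  assumes "is_graph X"
  shows "lifts_to X F u (p @ q) w \<longleftrightarrow> (\<exists>v. lifts_to X F u p v \<and> lifts_to X F v q w)"
proof
  assume "lifts_to X F u (p @ q) w"
  then show "\<exists>v. lifts_to X F u p v \<and> lifts_to X F v q w"
    unfolding lifts_to_def using edge_path_append[OF assms] by (fastforce simp: map_eq_append_conv)
next
  assume "\<exists>v. lifts_to X F u p v \<and> lifts_to X F v q w"
  then show "lifts_to X F u (p @ q) w"
    unfolding lifts_to_def using edge_path_append[OF assms] by (metis map_append)
qed

text \<open>If \<open>d\<close> lifts \<open>e\<close> from \<open>v\<close>, then \<open>d\<close>
  followed by \<open>bar X d\<close> lifts the backtrack and returns to \<open>v\<close>; uniqueness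
  of lifts excludes any other end.\<close>

lemma lifts_to_backtrack:
  assumes F: "locally_bijective X Y F" and X: "is_graph X"
    and v: "v \<in> verts X" and e: "e \<in> edges Y" "src Y e = F v"
  shows "lifts_to X F v [e, bar Y e] w \<longleftrightarrow> w = v"
proof -
  note FD = graph_mapD[OF locally_bijective_graph_map[OF F]]
  obtain d where d: "d \<in> edges X" "src X d = v" "F d = e"
    using lift_edge_exists[OF F v e] by blast
  have path: "edge_path X v [d, bar X d] v" "map F [d, bar X d] = [e, bar Y e]"
    using d is_graphD[OF X d(1)] FD v by auto
  then show ?thesis
    unfolding lifts_to_def using lift_path_unique[OF F X path(1)] by metis
qed

text \<open>The deleted backtrack acts as the identity on the ends of lifts, so it drops out of the
  composition of relations.\<close>

lemma lifts_to_backtrack_iff: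
  assumes F: "locally_bijective X Y F" and X: "is_graph X" and Y: "is_graph Y"
    and pq: "(p, q) \<in> backtrack Y (F u)"
  shows "lifts_to X F u p v \<longleftrightarrow> lifts_to X F u q v"
proof -
  obtain r e s where eq: "p = r @ [e, bar Y e] @ s" "q = r @ s"
    and l: "edge_path Y (F u) (r @ [e, bar Y e] @ s) (F u)"
    using pq unfolding backtrack_def loops_def by blast
  \<comment> \<open>The backtrack lifts from \<open>y\<close> only if \<open>e\<close> starts at
    \<open>F y\<close>. This holds since a lift of \<open>r\<close> ending at \<open>y\<close>
    projects to a path ending at \<open>F y\<close>, while \<open>r\<close> ends at the source of
    \<open>e\<close>.\<close>
  have "lifts_to X F y [e, bar Y e] w \<longleftrightarrow> w = y" if r: "lifts_to X F u r y" for y w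
  proof (rule lifts_to_backtrack[OF F X])
    obtain r' where r': "edge_path X u r' y" "map F r' = r" using r unfolding lifts_to_def by blast
    show "y \<in> verts X" using edge_path_verts[OF X r'(1)] by blast
    obtain z where z: "edge_path Y (F u) r z" "e \<in> edges Y" "src Y e = z"
      using l by (auto simp: edge_path_append[OF Y])
    then show "e \<in> edges Y" by blast
    have "edge_path Y (F u) r (F y)"
      using edge_path_map[OF locally_bijective_graph_map[OF F] r'(1)] r'(2) by simp
    then show "src Y e = F y" using z edge_path_end_unique by metis
  qed
  then show ?thesis unfolding eq by (auto simp: lifts_to_append[OF X] simp del: append_Cons)
qed

lemma lifts_to_homotopy:
  assumes F: "locally_bijective X Y F" and X: "is_graph X" and Y: "is_graph Y"
    and pq: "(p, q) \<in> homotopy Y (F u)" and p: "lifts_to X F u p v"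
  shows "lifts_to X F u q v"
proof -
  have "(p, q) \<in> (backtrack Y (F u) \<union> (backtrack Y (F u))\<inverse>)\<^sup>*"
    using pq unfolding homotopy_def by blast
  then show ?thesis
    by (induction rule: rtrancl_induct) (use p lifts_to_backtrack_iff[OF F X Y] in auto)
qed

text \<open>By \<open>sub\<close>, the loop \<open>map K L\<close> is homotopic to the image of a
  loop \<open>M\<close> at \<open>u\<close>. That image has the closed lift \<open>M\<close>, and
  the end of a lift is invariant under homotopy.\<close>

lemma loop_lifts_to_loop:
  assumes F: "locally_bijective X Y F" and X: "is_graph X" and Y: "is_graph Y"
    and K: "graph_map Q Y K" and base: "F u = K v"
    and sub: "pi1_map Y (K v) K ` carrier (pi1 Q v) \<subseteq> pi1_map Y (K v) F ` carrier (pi1 X u)"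
    and L: "L \<in> loops Q v"
  shows "lifts_to X F u (map K L) u"
proof -
  have "homotopy Q v `` {L} \<in> carrier (pi1 Q v)"
    using L by (auto simp: pi1_def intro: quotientI)
  then obtain B where B: "B \<in> loops X u // homotopy X u"
    and eq: "pi1_map Y (K v) K (homotopy Q v `` {L}) = pi1_map Y (K v) F B"
    using sub by (auto simp: pi1_def)
  have "map K L \<in> loops Y (K v)" using L edge_path_map[OF K] by (auto simp: loops_def)
  then have "map K L \<in> homotopy Y (K v) `` {map K L}"
    using equiv_class_self[OF equiv_homotopy] by metis
  then have "map K L \<in> pi1_map Y (K v) F B" using eq pi1_map_class[OF K L] by metis
  then obtain M where M: "M \<in> B" "(map F M, map K L) \<in> homotopy Y (K v)"
    unfolding pi1_map_def by auto
  have "M \<in> loops X u" using in_quotient_imp_subset[OF equiv_homotopy B] M(1) by (rule subsetD)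
  then have "lifts_to X F u (map F M) u" unfolding lifts_to_def loops_def by blast
  then show ?thesis using lifts_to_homotopy[OF F X Y] M(2) base by metis
qed

text \<open>Two paths from \<open>v\<close> with the same end form a loop, whose lift closes up.\<close>

lemma lift_end_unique:
  assumes F: "locally_bijective X Y F" and X: "is_graph X" and Y: "is_graph Y"
    and Q: "is_graph Q" and K: "graph_map Q Y K" and base: "F u = K v"
    and sub: "pi1_map Y (K v) K ` carrier (pi1 Q v) \<subseteq> pi1_map Y (K v) F ` carrier (pi1 X u)"
    and p: "edge_path Q v p w" "edge_path Q v p' w"
    and x: "lifts_to X F u (map K p) x" "lifts_to X F u (map K p') x'"
  shows "x = x'"
proof -
  have uniq: "y = y'" if "lifts_to X F z t y" "lifts_to X F z t y'" for z t y y'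
    using that lift_path_unique[OF F X] unfolding lifts_to_def by metis
  have "p @ rev (map (bar Q) p') \<in> loops Q v"
    using p edge_path_rev[OF Q p(2)] edge_path_append[OF Q] unfolding loops_def by blast
  from loop_lifts_to_loop[OF F X Y K base sub this]
  obtain y where y: "lifts_to X F u (map K p) y"
    "lifts_to X F y (map K (rev (map (bar Q) p'))) u"
    unfolding map_append lifts_to_append[OF X] by blast
  from y(2) have r: "lifts_to X F y (rev (map (bar Y) (map K p'))) u"
    using map_rev_path[OF K edge_path_edges[OF p(2)]] by simp
  have "set (map K p') \<subseteq> edges Y" using edge_path_edges[OF edge_path_map[OF K p(2)]] .
  \<comment> \<open>The second half of the closed lift runs from \<open>y\<close> back to
    \<open>u\<close> over the reverse of \<open>map K p'\<close>. Read backwards, it lifts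
    \<open>map K p'\<close> from \<open>u\<close> to \<open>y\<close>, so both lifts end at
    \<open>y\<close>.\<close>
  then have "lifts_to X F u (map K p') y"
    using r edge_path_rev[OF X] map_rev_path[OF locally_bijective_graph_map[OF F] edge_path_edges]
      rev_path_rev_path[OF Y] unfolding lifts_to_def by metis
  then show ?thesis using uniq x y(1) by metis
qed

text \<open>The classical construction: a vertex is sent to the end of the lift of any path leading
  to it from \<open>v\<close>. Path connectedness provides a path, and \<open>sub\<close> makes the
  end independent of it.\<close>

lemma lifting_criterion:
  assumes F: "locally_bijective X Y F" and X: "is_graph X" and Y: "is_graph Y"
    and Q: "is_graph Q" and conn: "graph_path_connected Q"
    and K: "graph_map Q Y K" and u: "u \<in> verts X" and v: "v \<in> verts Q" and base: "F u = K v"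
    and sub: "pi1_map Y (K v) K ` carrier (pi1 Q v) \<subseteq> pi1_map Y (K v) F ` carrier (pi1 X u)"
  obtains H where "graph_map Q X H" "H v = u" "\<And>x. x \<in> points Q \<Longrightarrow> F (H x) = K x"
proof -
  note FD = graph_mapD[OF locally_bijective_graph_map[OF F]]
  note KD = graph_mapD[OF K]
  define end_of where "end_of w x \<longleftrightarrow> (\<exists>p. edge_path Q v p w \<and> lifts_to X F u (map K p) x)" for w x
  have ex: "\<exists>x. end_of w x" if w: "w \<in> verts Q" for w
  proof -
    obtain p where p: "edge_path Q v p w" using conn v w unfolding graph_path_connected_def by blast
    have "edge_path Y (F u) (map K p) (K w)" using edge_path_map[OF K p] base by simp
    from lift_path_exists[OF F X u this] show ?thesis
      unfolding end_of_def lifts_to_def using p by blast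
  qed
  have uniq: "x = x'" if "end_of w x" "end_of w x'" for w x x'
    using that lift_end_unique[OF F X Y Q K base sub] unfolding end_of_def by blast
  have endD: "x \<in> verts X \<and> F x = K w" if "end_of w x" for w x
  proof -
    obtain p q where p: "edge_path Q v p w" and q: "edge_path X u q x" "map F q = map K p"
      using \<open>end_of w x\<close> unfolding end_of_def lifts_to_def by blast
    have "edge_path Y (F u) (map K p) (F x)"
      using edge_path_map[OF locally_bijective_graph_map[OF F] q(1)] q(2) by simp
    moreover have "edge_path Y (F u) (map K p) (K w)" using edge_path_map[OF K p] base by simp
    ultimately show ?thesis using edge_path_verts[OF X q(1)] edge_path_end_unique by metis
  qed
  define Hv where "Hv w = (SOME x. end_of w x)" for w
  have Hv: "end_of w (Hv w)" if "w \<in> verts Q" for w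
    unfolding Hv_def using someI_ex[OF ex[OF that]] .
  \<comment> \<open>An edge must go to the lift of its image that starts at the value already fixed
    for its source; targets and \<open>bar\<close> then have to be checked.\<close>
  define He where "He e = (SOME d. d \<in> edges X \<and> src X d = Hv (src Q e) \<and> F d = K e)" for e
  have He: "He e \<in> edges X \<and> src X (He e) = Hv (src Q e) \<and> F (He e) = K e" if e: "e \<in> edges Q" for e
  proof -
    have "\<exists>d\<in>edges X. src X d = Hv (src Q e) \<and> F d = K e"
      using endD[OF Hv[OF is_graphD(1)[OF Q e]]] KD(2,3)[OF e] lift_edge_exists[OF F] by metis
    then show ?thesis unfolding He_def by (metis (mono_tags, lifting) someI_ex)
  qed
  \<comment> \<open>A path to the source of \<open>e\<close>, extended by \<open>e\<close>, is a
    path to its target. Its lift ends with \<open>He e\<close>, and independence of the path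
    identifies the two ends.\<close>
  have tgt: "Hv (tgt Q e) = tgt X (He e)" if e: "e \<in> edges Q" for e
  proof -
    have vs: "src Q e \<in> verts Q" "tgt Q e \<in> verts Q" using is_graphD[OF Q e] by auto
    obtain p where p: "edge_path Q v p (src Q e)" "lifts_to X F u (map K p) (Hv (src Q e))"
      using Hv[OF vs(1)] unfolding end_of_def by blast
    have "edge_path Q v (p @ [e]) (tgt Q e)"
      using p(1) e vs by (auto simp: edge_path_append[OF Q])
    moreover have "lifts_to X F (Hv (src Q e)) [K e] (tgt X (He e))"
      unfolding lifts_to_def using He[OF e] is_graphD[OF X] by (intro exI[of _ "[He e]"]) auto
    then have "lifts_to X F u (map K (p @ [e])) (tgt X (He e))"
      using p(2) lifts_to_append[OF X] by fastforce
    ultimately show ?thesis using Hv[OF vs(2)] uniq unfolding end_of_def by blast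
  qed
  \<comment> \<open>Both edges start at \<open>Hv (tgt Q e)\<close> and lie over the same edge of
    \<open>Y\<close>.\<close>
  have bar: "He (bar Q e) = bar X (He e)" if e: "e \<in> edges Q" for e
  proof (rule lift_edge_unique[OF F X])
    note b = is_graphD[OF Q e] and h = He[OF e]
    show "He (bar Q e) \<in> edges X" using He[OF b(3)] by blast
    show "bar X (He e) \<in> edges X" using is_graphD[OF X] h by blast
    show "src X (He (bar Q e)) = src X (bar X (He e))"
      using He[OF b(3)] b(6) tgt[OF e] is_graphD(6)[OF X] h by metis
    show "F (He (bar Q e)) = F (bar X (He e))"
      using He[OF b(3)] h FD(5) KD(5)[OF e] by metis
  qed
  define H where "H x = (if x \<in> verts Q then Hv x else He x)" for x
  have HV: "H x = Hv x" if "x \<in> verts Q" for x using that by (simp add: H_def)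
  have HE: "H x = He x" if "x \<in> edges Q" for x
    using that is_graph_disjoint[OF Q] by (auto simp: H_def)
  show thesis
  proof (rule that[of H])
    show "graph_map Q X H"
      unfolding graph_map_def
      using Hv endD He tgt bar is_graphD[OF Q] by (auto simp: HV HE)
    have "end_of v u" unfolding end_of_def lifts_to_def using u v
      by (intro exI[of _ "[]"]) auto
    then show "H v = u" using HV[OF v] Hv[OF v] uniq by metis
    show "F (H x) = K x" if "x \<in> points Q" for x
      using that Hv endD He unfolding points_def by (auto simp: HV HE)
  qed
qed


section \<open>Quotient graphs\<close>

text \<open>Symmetry lets the separation of vertices from edges work in both directions, so it is
  enough to know the kind of one of two related points.\<close>

lemma compatibleD:
  assumes "compatible G R"
  shows "equiv (points G) R"
    "v \<in> verts G \<Longrightarrow> (v, x) \<in> R \<Longrightarrow> x \<in> verts G"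
    "e \<in> edges G \<Longrightarrow> (e, x) \<in> R \<Longrightarrow> x \<in> edges G"
    "e \<in> edges G \<Longrightarrow> (e, e') \<in> R \<Longrightarrow> (src G e, src G e') \<in> R"
    "e \<in> edges G \<Longrightarrow> (e, e') \<in> R \<Longrightarrow> (tgt G e, tgt G e') \<in> R"
    "e \<in> edges G \<Longrightarrow> (e, e') \<in> R \<Longrightarrow> (bar G e, bar G e') \<in> R"
    "e \<in> edges G \<Longrightarrow> (e, bar G e) \<notin> R"
proof -
  show E: "equiv (points G) R" using assms unfolding compatible_def by blast
  have *: "x \<in> points G" "(x, y) \<in> R" if "(y, x) \<in> R" for x y
    using that E by (auto simp: equiv_def sym_def)
  show "v \<in> verts G \<Longrightarrow> (v, x) \<in> R \<Longrightarrow> x \<in> verts G"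
    using assms * unfolding compatible_def points_def by blast
  show ee: "e \<in> edges G \<Longrightarrow> (e, x) \<in> R \<Longrightarrow> x \<in> edges G" for x
    using assms * unfolding compatible_def points_def by blast
  show "e \<in> edges G \<Longrightarrow> (e, e') \<in> R \<Longrightarrow> (src G e, src G e') \<in> R"
    "e \<in> edges G \<Longrightarrow> (e, e') \<in> R \<Longrightarrow> (tgt G e, tgt G e') \<in> R"
    "e \<in> edges G \<Longrightarrow> (e, e') \<in> R \<Longrightarrow> (bar G e, bar G e') \<in> R"
    "e \<in> edges G \<Longrightarrow> (e, bar G e) \<notin> R"
    using assms ee unfolding compatible_def by blast+
qed

text \<open>The structure maps of \<open>quotient_graph\<close> saturate the image of a whole class;
  when \<open>m\<close> respects \<open>R\<close> along the class, that image lies in a single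
  class.\<close>

lemma class_of_image_class:
  assumes R: "equiv A R" and x: "x \<in> A" and m: "\<And>y. (x, y) \<in> R \<Longrightarrow> (m x, m y) \<in> R"
  shows "R `` (m ` (R `` {x})) = R `` {m x}"
proof -
  have "R `` {m y} = R `` {m x}" if "(x, y) \<in> R" for y
    using equiv_class_eq[OF R m[OF that]] by simp
  then have "(\<Union>y\<in>R `` {x}. R `` {m y}) = (\<Union>y\<in>R `` {x}. R `` {m x})" by simp
  moreover have "x \<in> R `` {x}" using equiv_class_self[OF R x] .
  moreover have "R `` (m ` (R `` {x})) = (\<Union>y\<in>R `` {x}. R `` {m y})" by blast
  ultimately show ?thesis by auto
qed

lemma quotient_graph_simps:
  assumes R: "compatible G R" and e: "e \<in> edges G"
  shows "src (quotient_graph G R) (R `` {e}) = R `` {src G e}"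
    "tgt (quotient_graph G R) (R `` {e}) = R `` {tgt G e}"
    "bar (quotient_graph G R) (R `` {e}) = R `` {bar G e}"
  using class_of_image_class[OF compatibleD(1)[OF R], of e] compatibleD(4-6)[OF R e] e
  by (auto simp: quotient_graph_def points_def)

lemma graph_map_quotient:
  assumes R: "compatible G R"
  shows "graph_map G (quotient_graph G R) (\<lambda>x. R `` {x})"
  unfolding graph_map_def
  by (auto simp: quotient_graph_simps[OF R]) (auto simp: quotient_graph_def intro: quotientI)

lemma quotient_graph_cases:
  shows "C \<in> verts (quotient_graph G R) \<Longrightarrow> \<exists>v\<in>verts G. C = R `` {v}"
    "C \<in> edges (quotient_graph G R) \<Longrightarrow> \<exists>e\<in>edges G. C = R `` {e}"
  by (auto simp: quotient_graph_def quotient_def)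

lemma is_graph_quotient:
  assumes G: "is_graph G" and R: "compatible G R"
  shows "is_graph (quotient_graph G R)"
proof -
  let ?Q = "quotient_graph G R"
  note E = compatibleD(1)[OF R]
  note QD = graph_mapD[OF graph_map_quotient[OF R]]
  have eq: "R `` {x} = R `` {y} \<longleftrightarrow> (x, y) \<in> R" if "x \<in> points G" "y \<in> points G" for x y
    using eq_equiv_class_iff[OF E that] .
  have "R `` {v} \<noteq> R `` {e}" if "v \<in> verts G" "e \<in> edges G" for v e
    using that eq[of v e] R unfolding compatible_def points_def by blast
  then have "verts ?Q \<inter> edges ?Q = {}" using quotient_graph_cases by fastforce
  \<comment> \<open>Here the condition that no edge is related to its inverse ensures that the
    quotient has no edge equal to its own inverse.\<close>
  moreover have "R `` {bar G e} \<noteq> R `` {e}" if e: "e \<in> edges G" for e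
    using eq[of e "bar G e"] compatibleD(7)[OF R e] is_graphD[OF G e] e
    unfolding points_def by blast
  moreover have "src ?Q C \<in> verts ?Q \<and> tgt ?Q C \<in> verts ?Q \<and> bar ?Q C \<in> edges ?Q \<and>
      bar ?Q (bar ?Q C) = C \<and> src ?Q (bar ?Q C) = tgt ?Q C \<and> tgt ?Q (bar ?Q C) = src ?Q C"
    if C: "C \<in> edges ?Q" for C
  proof -
    obtain e where e: "e \<in> edges G" and Ce: "C = R `` {e}" using quotient_graph_cases(2)[OF C] by blast
    note b = is_graphD[OF G e]
    show ?thesis
      unfolding Ce
      using b(4,6,7) QD(1)[OF b(1)] QD(1)[OF b(2)] QD(2)[OF b(3)]
      by (simp add: quotient_graph_simps[OF R e] quotient_graph_simps[OF R b(3)])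
  qed
  ultimately show ?thesis
    unfolding is_graph_def by (metis quotient_graph_cases(2) quotient_graph_simps(3)[OF R])
qed

text \<open>The image of the class under \<open>k\<close> is a singleton, so \<open>the_elem\<close>
  returns a meaningful value.\<close>

lemma class_map_class:
  assumes "equiv A R" "x \<in> A" "\<And>y. (x, y) \<in> R \<Longrightarrow> k y = k x"
  shows "class_map k (R `` {x}) = k x"
proof -
  have "k ` (R `` {x}) \<subseteq> {k x}" using assms(3) by blast
  moreover have "k x \<in> k ` (R `` {x})" using equiv_class_self[OF assms(1,2)] by (rule imageI)
  ultimately have "k ` (R `` {x}) = {k x}" by blast
  then show ?thesis by (simp add: class_map_def)
qed

lemma graph_map_class_map:
  assumes G: "is_graph G" and R: "compatible G R" and k: "graph_map G X k"
    and const: "\<And>x y. (x, y) \<in> R \<Longrightarrow> k x = k y"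
  shows "graph_map (quotient_graph G R) X (class_map k)"
proof -
  have cm: "class_map k (R `` {x}) = k x" if "x \<in> points G" for x
    using class_map_class[OF compatibleD(1)[OF R] that] const by metis
  have cmv: "class_map k (R `` {x}) = k x" if "x \<in> verts G" for x
    using cm that by (simp add: points_def)
  have cme: "class_map k (R `` {x}) = k x" if "x \<in> edges G" for x
    using cm that by (simp add: points_def)
  have "class_map k C \<in> verts X" if "C \<in> verts (quotient_graph G R)" for C
    using quotient_graph_cases(1)[OF that] cmv graph_mapD(1)[OF k] by auto
  moreover have "class_map k C \<in> edges X \<and>
      class_map k (src (quotient_graph G R) C) = src X (class_map k C) \<and>
      class_map k (tgt (quotient_graph G R) C) = tgt X (class_map k C) \<and>
      class_map k (bar (quotient_graph G R) C) = bar X (class_map k C)"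
    if C: "C \<in> edges (quotient_graph G R)" for C
  proof -
    obtain e where e: "e \<in> edges G" "C = R `` {e}" using quotient_graph_cases(2)[OF C] by blast
    then show ?thesis
      using graph_mapD(2-5)[OF k e(1)] is_graphD(1-3)[OF G e(1)]
      by (simp add: quotient_graph_simps[OF R] cmv cme)
  qed
  ultimately show ?thesis unfolding graph_map_def by blast
qed

text \<open>Both negative conditions are pulled back from \<open>X\<close>: its vertices differ from
  its edges, and its edges differ from their inverses.\<close>

lemma compatible_kernel:
  assumes G: "is_graph G" and X: "is_graph X" and k: "graph_map G X k"
  shows "compatible G {(x, y) \<in> points G \<times> points G. k x = k y}"
  unfolding compatible_def
proof (intro conjI ballI impI)
  show "equiv (points G) {(x, y) \<in> points G \<times> points G. k x = k y}"
    by (auto simp: equiv_def refl_on_def sym_def trans_def)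
next
  fix v e assume "v \<in> verts G" "e \<in> edges G"
  then have "k v \<noteq> k e" using graph_mapD[OF k] is_graph_disjoint[OF X] by metis
  then show "(v, e) \<notin> {(x, y) \<in> points G \<times> points G. k x = k y}" by simp
next
  fix e assume e: "e \<in> edges G"
  have "k (bar G e) \<noteq> k e" using graph_mapD[OF k] is_graphD(5)[OF X] e by metis
  then show "(e, bar G e) \<notin> {(x, y) \<in> points G \<times> points G. k x = k y}" by simp
qed (auto simp: points_def is_graphD[OF G] graph_mapD[OF k])

lemma compatible_Int:
  assumes "compatible G R" "compatible G S"
  shows "compatible G (R \<inter> S)"
proof -
  have "equiv (points G) (R \<inter> S)"
    using assms(1,2)[THEN compatibleD(1)]
    by (auto simp: equiv_def refl_on_def intro: sym_Int trans_Int)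
  then show ?thesis using assms unfolding compatible_def by simp
qed

text \<open>A class of \<open>R \<inter> S\<close> is the intersection of a class of
  \<open>R\<close> with a class of \<open>S\<close>.\<close>

lemma finite_quotient_Int:
  assumes "finite (A // R)" "finite (A // S)"
  shows "finite (A // (R \<inter> S))"
proof (rule finite_subset)
  have "(R \<inter> S) `` {x} = R `` {x} \<inter> S `` {x}" for x by blast
  then show "A // (R \<inter> S) \<subseteq> (\<lambda>(B, C). B \<inter> C) ` ((A // R) \<times> (A // S))"
    by (auto simp: quotient_def)
qed (use assms in auto)

text \<open>Two maps, each constant on the classes of its own entourage, can thus be compared over
  one common quotient.\<close>

lemma compatible_cofinite_entourage_Int:
  assumes "compatible_cofinite_entourage G R" "compatible_cofinite_entourage G S"
  shows "compatible_cofinite_entourage G (R \<inter> S)"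
  using assms compatible_Int finite_quotient_Int
  unfolding compatible_cofinite_entourage_def entourage_def
  by (auto elim: eventually_elim2)

text \<open>Paths exist in the quotient only, hence \<open>k\<close> and \<open>k'\<close> are compared on classes.\<close>

lemma lift_unique:
  assumes F: "locally_bijective X Y F" and X: "is_graph X"
    and G: "is_graph G" and R: "compatible G R" and conn: "graph_path_connected (quotient_graph G R)"
    and k: "graph_map G X k" and k': "graph_map G X k'"
    and const: "\<And>x y. (x, y) \<in> R \<Longrightarrow> k x = k y \<and> k' x = k' y"
    and eq: "\<And>x. x \<in> points G \<Longrightarrow> F (k x) = F (k' x)"
    and c: "c \<in> verts G" "k c = k' c" and x: "x \<in> points G"
  shows "k x = k' x"
proof -
  let ?Q = "quotient_graph G R"
  have edge: "k e = k' e" if e: "e \<in> edges G" and s: "k (src G e) = k' (src G e)" for e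
    using lift_edge_unique[OF F X, of "k e" "k' e"] graph_mapD[OF k] graph_mapD[OF k'] e s eq
    by (metis points_def UnCI)
  have class_eqD: "(y, z) \<in> R" if "R `` {y} = R `` {z}" "y \<in> points G" "z \<in> points G" for y z
    using that eq_equiv_class_iff[OF compatibleD(1)[OF R]] by metis
  have path: "k v = k' v"
    if "edge_path ?Q (R `` {u}) p (R `` {v})" "u \<in> verts G" "v \<in> verts G" "k u = k' u" for p u v
    using that
  proof (induction p arbitrary: u)
    case Nil
    then have "(u, v) \<in> R" using class_eqD by (auto simp: points_def)
    then show ?case using const Nil by metis
  next
    case (Cons C p)
    then obtain e where e: "e \<in> edges G" "C = R `` {e}" using quotient_graph_cases(2) by force
    have vs: "src G e \<in> verts G" "tgt G e \<in> verts G" using is_graphD[OF G e(1)] by auto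
    have "R `` {src G e} = R `` {u}" using Cons.prems e quotient_graph_simps[OF R] by auto
    \<comment> \<open>Consecutive edges of the quotient path need not meet in \<open>G\<close>: the
      representative \<open>e\<close> starts only at a point related to \<open>u\<close>. Constancy
      on classes bridges the gap.\<close>
    then have "(src G e, u) \<in> R" using class_eqD vs Cons.prems by (auto simp: points_def)
    then have "k (src G e) = k' (src G e)" using const Cons.prems by metis
    then have "k e = k' e" using edge e by blast
    then have "k (tgt G e) = k' (tgt G e)" using graph_mapD(4)[OF k] graph_mapD(4)[OF k'] e by metis
    then show ?case
      using Cons.IH[of "tgt G e"] Cons.prems vs e quotient_graph_simps(2)[OF R e(1)] by auto
  qed
  have vert: "k v = k' v" if v: "v \<in> verts G" for v
  proof -
    have "R `` {c} \<in> verts ?Q" "R `` {v} \<in> verts ?Q"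
      using graph_mapD(1)[OF graph_map_quotient[OF R]] v c by blast+
    then obtain p where "edge_path ?Q (R `` {c}) p (R `` {v})"
      using conn unfolding graph_path_connected_def by blast
    then show ?thesis using path v c by blast
  qed
  show ?thesis using x vert edge is_graphD(1)[OF G] unfolding points_def by blast
qed


section \<open>Locally constant maps on cofinite graphs\<close>

text \<open>By transitivity, every point of the class has its whole \<open>R\<close>-neighbourhood
  inside the class.\<close>

lemma open_entourage_class:
  fixes R :: "('a::uniform_space \<times> 'a) set"
  assumes "entourage R" "equiv UNIV R"
  shows "open (R `` {x})"
  unfolding open_uniformity
proof
  fix y assume y: "y \<in> R `` {x}"
  have "eventually (\<lambda>p. p \<in> R) uniformity" using assms(1) by (simp add: entourage_def)
  then show "\<forall>\<^sub>F (x', z) in uniformity. x' = y \<longrightarrow> z \<in> R `` {x}"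
  proof eventually_elim
    case (elim p)
    then show ?case using y assms(2) by (auto simp: equiv_def dest: transD)
  qed
qed

text \<open>A locally constant map on a compact space is uniformly continuous into a discrete space:
  finitely many classes on which \<open>k\<close> is constant cover the space, and the corresponding
  entourages are intersected.\<close>

lemma entourage_kernel:
  fixes G :: "'a::{uniform_space, t2_space} graph" and k :: "'a \<Rightarrow> 'b"
  assumes G: "profinite_graph G" and k: "\<And>z. open (k -` {z})"
  shows "entourage {(x, y). k x = k y}"
proof -
  have cof: "cofinite_graph G" and pt: "points G = UNIV" and cpt: "compact (UNIV :: 'a set)"
    using G unfolding profinite_graph_def cofinite_graph_def by auto
  have "\<exists>R. compatible_cofinite_entourage G R \<and> R `` {x} \<subseteq> k -` {k x}" for x
  proof -
    \<comment> \<open>Openness of the fibre at \<open>x\<close> as an entourage: it restricts only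
      pairs that begin at \<open>x\<close>, so an equivalence relation inside it has its class of
      \<open>x\<close> in the fibre.\<close>
    have "entourage {(x', y). x' = x \<longrightarrow> k y = k x}"
      using k[of "k x"] unfolding open_uniformity entourage_def by (auto simp: case_prod_unfold)
    then obtain R where "compatible_cofinite_entourage G R"
      "R \<subseteq> {(x', y). x' = x \<longrightarrow> k y = k x}"
      using cof unfolding cofinite_graph_def by blast
    then show ?thesis by blast
  qed
  then obtain R where R: "\<And>x. compatible_cofinite_entourage G (R x)"
    and Rk: "\<And>x. R x `` {x} \<subseteq> k -` {k x}" by metis
  have E: "equiv UNIV (R x)" and ent: "entourage (R x)" for x
    using R[of x] pt unfolding compatible_cofinite_entourage_def compatible_def by auto
  have "UNIV \<subseteq> (\<Union>x\<in>UNIV. R x `` {x})" using E equiv_class_self by fastforce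
  then obtain D where D: "finite D" "UNIV \<subseteq> (\<Union>x\<in>D. R x `` {x})"
    using compactE_image[OF cpt, of UNIV "\<lambda>x. R x `` {x}"]
      open_entourage_class[OF ent E] by metis
  have "eventually (\<lambda>p. \<forall>x\<in>D. p \<in> R x) uniformity"
    using ent D(1) by (simp add: entourage_def eventually_ball_finite)
  then show ?thesis
    unfolding entourage_def
  proof eventually_elim
    case (elim p)
    obtain y z where p: "p = (y, z)" by (cases p)
    obtain x where x: "x \<in> D" "(x, y) \<in> R x" using D(2) by blast
    then have "(x, z) \<in> R x" using elim p E[of x] by (auto simp: equiv_def dest: transD)
    \<comment> \<open>Both \<open>y\<close> and \<open>z\<close> lie in the class of the same centre
      \<open>x\<close>, on which \<open>k\<close> takes the value \<open>k x\<close>.\<close>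
    then have "y \<in> k -` {k x}" "z \<in> k -` {k x}" using x Rk[of x] by blast+
    then show ?case using p by simp
  qed
qed

lemma compatible_cofinite_entourage_kernel:
  fixes G :: "'a::{uniform_space, t2_space} graph"
  assumes G: "profinite_graph G" and X: "is_graph X" "finite (points X)"
    and k: "graph_map G X k" and op: "\<And>z. open (k -` {z})"
  shows "compatible_cofinite_entourage G {(x, y). k x = k y}"
proof -
  have gr: "is_graph G" and pt: "points G = UNIV"
    using G unfolding profinite_graph_def cofinite_graph_def by auto
  have "range k \<subseteq> points X" using graph_mapD(6)[OF k] pt by blast
  then have "finite (range k)" using X(2) finite_subset by blast
  \<comment> \<open>A class of the kernel is determined by the value of \<open>k\<close> on it, so
    there are at most as many classes as values.\<close>
  moreover have "UNIV // {(x, y). k x = k y} \<subseteq> (\<lambda>z. {y. z = k y}) ` range k"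
    by (auto simp: quotient_def)
  ultimately have "finite (UNIV // {(x, y). k x = k y})" by (meson finite_imageI finite_subset)
  then show ?thesis
    using compatible_kernel[OF gr X(1) k] entourage_kernel[OF G op] pt
    unfolding compatible_cofinite_entourage_def by simp
qed

lemma open_vimage_const_on_classes:
  fixes T :: "('a::uniform_space \<times> 'a) set" and k :: "'a \<Rightarrow> 'b"
  assumes "entourage T" "equiv UNIV T" "\<And>x y. (x, y) \<in> T \<Longrightarrow> k x = k y"
  shows "open (k -` Z)"
proof -
  have "k -` Z = (\<Union>x\<in>k -` Z. T `` {x})"
    using assms(3) equiv_class_self[OF assms(2)] by fastforce
  then show ?thesis using open_entourage_class[OF assms(1,2)] by (metis open_UN)
qed


section \<open>Inverse limits\<close>

text \<open>The projection is a coordinate of a continuous map into a product of discrete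
  spaces.\<close>

lemma inverse_limit_open_vimage:
  assumes L: "is_inverse_limit G I leq X \<phi> p" and pt: "points G = UNIV" and i: "i \<in> I"
  shows "open (p i -` {z})"
proof -
  let ?P = "product_topology (\<lambda>i. discrete_topology (points (X i))) I"
  have "continuous_map (top_of_set UNIV) (subtopology ?P (threads I leq X \<phi>)) (\<lambda>x. \<lambda>i\<in>I. p i x)"
    using L pt unfolding is_inverse_limit_def by (simp add: homeomorphic_imp_continuous_map)
  then have "continuous_map euclidean ?P (\<lambda>x. \<lambda>i\<in>I. p i x)"
    by (simp add: continuous_map_in_subtopology)
  then have "continuous_map euclidean (discrete_topology (points (X i))) (p i)"
    using i by (auto simp: continuous_map_componentwise)
  \<comment> \<open>The intersection with \<open>points (X i)\<close> covers the case of a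
    \<open>z\<close> outside the stage, where \<open>{z}\<close> is not a subset of the discrete
    space.\<close>
  then have "openin euclidean {x \<in> topspace euclidean. p i x \<in> {z} \<inter> points (X i)}"
    by (rule openin_continuous_map_preimage) auto
  moreover have "p i x \<in> points (X i)" for x
    using L i pt graph_mapD(6) unfolding is_inverse_limit_def by (metis UNIV_I)
  then have "{x \<in> topspace euclidean. p i x \<in> {z} \<inter> points (X i)} = p i -` {z}"
    by auto
  ultimately show ?thesis by simp
qed

lemma inverse_limit_eqI:
  assumes L: "is_inverse_limit G I leq X \<phi> p" and pt: "points G = UNIV"
    and eq: "\<And>i. i \<in> I \<Longrightarrow> p i x = p i y"
  shows "x = y"
proof -
  have "inj (\<lambda>x. \<lambda>i\<in>I. p i x)"
    using L pt homeomorphic_imp_injective_map unfolding is_inverse_limit_def by fastforce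
  moreover have "(\<lambda>i\<in>I. p i x) = (\<lambda>i\<in>I. p i y)" using eq by auto
  ultimately show ?thesis by (auto dest: injD)
qed

text \<open>The maps \<open>h i\<close> combine into a continuous map to the space of threads, which
  is composed with the inverse of the homeomorphism onto that space.\<close>

lemma inverse_limit_universal:
  fixes G :: "'a::topological_space graph" and S :: "'s::topological_space graph"
  assumes L: "is_inverse_limit G I leq X \<phi> p" and pt: "points G = UNIV" and ne: "I \<noteq> {}"
    and X: "\<And>i. i \<in> I \<Longrightarrow> is_graph (X i)"
    and S: "is_graph S" "points S = UNIV"
    and h: "\<And>i. i \<in> I \<Longrightarrow> graph_map S (X i) (h i)"
    and op: "\<And>i Z. i \<in> I \<Longrightarrow> open (h i -` Z)"
    and comp: "\<And>i j x. \<lbrakk>i \<in> I; j \<in> I; leq i j\<rbrakk> \<Longrightarrow> \<phi> i j (h j x) = h i x"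
  obtains H where "graph_map S G H" "continuous_on UNIV H" "\<And>i x. i \<in> I \<Longrightarrow> p i (H x) = h i x"
proof -
  let ?P = "product_topology (\<lambda>i. discrete_topology (points (X i))) I"
  let ?T = "threads I leq X \<phi>" and ?e = "\<lambda>x. \<lambda>i\<in>I. p i x" and ?h = "\<lambda>x. \<lambda>i\<in>I. h i x"
  have hpt: "h i x \<in> points (X i)" if "i \<in> I" for i x
    using graph_mapD(6)[OF h[OF that]] S by auto
  have thr: "?h x \<in> ?T" for x
    using hpt comp by (auto simp: threads_def)
  have sub: "?T \<subseteq> topspace ?P" by (auto simp: threads_def)
  have hom: "homeomorphic_map euclidean (subtopology ?P ?T) ?e"
    using L pt unfolding is_inverse_limit_def by simp
  then obtain r where r: "homeomorphic_maps euclidean (subtopology ?P ?T) ?e r"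
    using homeomorphic_map_maps by blast
  have rc: "continuous_map (subtopology ?P ?T) euclidean r"
    and er: "\<And>z. z \<in> ?T \<Longrightarrow> ?e (r z) = z"
    using r sub unfolding homeomorphic_maps_def by (auto simp: Int_absorb1)
  have "continuous_map euclidean (discrete_topology (points (X i))) (h i)" if "i \<in> I" for i
    using hpt[OF that] op[OF that] by (auto simp: continuous_map_def vimage_def)
  then have "continuous_map euclidean ?P ?h"
    by (auto simp: continuous_map_componentwise)
  then have "continuous_map euclidean (subtopology ?P ?T) ?h"
    using thr by (auto simp: continuous_map_in_subtopology)
  then have "continuous_map euclidean euclidean (r \<circ> ?h)"
    using rc continuous_map_compose by blast
  then have cont: "continuous_on UNIV (r \<circ> ?h)" by simp
  have pr: "p i ((r \<circ> ?h) x) = h i x" if "i \<in> I" for i x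
    using fun_cong[OF er[OF thr[of x]], of i] that by simp
  have pm: "graph_map G (X i) (p i)" if "i \<in> I" for i
    using L that unfolding is_inverse_limit_def by blast
  have cases: "y \<in> verts G \<or> y \<in> edges G" for y using pt unfolding points_def by blast
  \<comment> \<open>A single stage suffices to tell vertices of \<open>G\<close> from edges, since
    its projection preserves the kind of a point.\<close>
  obtain i where i: "i \<in> I" using ne by blast
  have V: "(r \<circ> ?h) x \<in> verts G" if "x \<in> verts S" for x
    using cases[of "(r \<circ> ?h) x"] graph_mapD(2)[OF pm[OF i]] graph_mapD(1)[OF h[OF i] that]
      is_graph_disjoint[OF X[OF i]] pr[OF i, of x] by metis
  have E: "(r \<circ> ?h) x \<in> edges G" if "x \<in> edges S" for x
    using cases[of "(r \<circ> ?h) x"] graph_mapD(1)[OF pm[OF i]] graph_mapD(2)[OF h[OF i] that]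
      is_graph_disjoint[OF X[OF i]] pr[OF i, of x] by metis
  have "graph_map S G (r \<circ> ?h)"
    unfolding graph_map_def
  proof (intro conjI ballI)
    fix e assume e: "e \<in> edges S"
    \<comment> \<open>The projections separate points, so the identities for the structure maps are
      checked at each stage.\<close>
    show "(r \<circ> ?h) (src S e) = src G ((r \<circ> ?h) e)"
      using inverse_limit_eqI[OF L pt] pr graph_mapD(3)[OF pm E[OF e]] graph_mapD(3)[OF h e] by metis
    show "(r \<circ> ?h) (tgt S e) = tgt G ((r \<circ> ?h) e)"
      using inverse_limit_eqI[OF L pt] pr graph_mapD(4)[OF pm E[OF e]] graph_mapD(4)[OF h e] by metis
    show "(r \<circ> ?h) (bar S e) = bar G ((r \<circ> ?h) e)"
      using inverse_limit_eqI[OF L pt] pr graph_mapD(5)[OF pm E[OF e]] graph_mapD(5)[OF h e] by metis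
  qed (use V E in auto)
  then show thesis using that cont pr by blast
qed


section \<open>Lifting along a covering of profinite graphs\<close>

theorem theorem5:
  fixes \<Gamma> :: "'a::{uniform_space, t2_space} graph"
    and \<Delta> :: "'b::{uniform_space, t2_space} graph"
    and \<Sigma> :: "'s::{uniform_space, t2_space} graph"
    and I :: "'i set" and leq :: "'i \<Rightarrow> 'i \<Rightarrow> bool"
    and \<Gamma>s :: "'i \<Rightarrow> 'c graph" and \<Delta>s :: "'i \<Rightarrow> 'd graph"
    and \<phi>s :: "'i \<Rightarrow> 'i \<Rightarrow> 'c \<Rightarrow> 'c" and \<psi>s :: "'i \<Rightarrow> 'i \<Rightarrow> 'd \<Rightarrow> 'd"
    and \<phi> :: "'i \<Rightarrow> 'a \<Rightarrow> 'c" and \<psi> :: "'i \<Rightarrow> 'b \<Rightarrow> 'd"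
    and f :: "'a \<Rightarrow> 'b" and fs :: "'i \<Rightarrow> 'c \<Rightarrow> 'd" and g :: "'s \<Rightarrow> 'b"
    and a :: 'a and b :: 'b and c :: 's
  assumes "covering_limit \<Gamma> \<Delta> f I leq \<Gamma>s \<Delta>s fs \<phi>s \<psi>s \<phi> \<psi>"
    and "\<And>i. i \<in> I \<Longrightarrow> \<psi> i ` points \<Delta> = points (\<Delta>s i)"
    and "connected_profinite_graph \<Sigma>"
    and "graph_map \<Sigma> \<Delta> g" and "continuous_on UNIV g"
    and "a \<in> verts \<Gamma>" and "b \<in> verts \<Delta>" and "c \<in> verts \<Sigma>"
    and "f a = b" and "g c = b"
  shows "(\<exists>!h :: 's \<Rightarrow> 'a. graph_map \<Sigma> \<Gamma> h \<and> continuous_on UNIV h \<and> h c = a \<and> f \<circ> h = g) \<longleftrightarrow>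
    (\<forall>i\<in>I. \<exists>T. compatible_cofinite_entourage \<Sigma> T \<and>
       map_prod g g ` T \<subseteq> {(x, y). \<psi> i x = \<psi> i y} \<and>
       pi1_map (\<Delta>s i) (\<psi> i b) (class_map (\<lambda>x. \<psi> i (g x)))
         ` carrier (pi1 (quotient_graph \<Sigma> T) (T `` {c}))
       \<subseteq> pi1_map (\<Delta>s i) (\<psi> i b) (fs i) ` carrier (pi1 (\<Gamma>s i) (\<phi> i a)))"
proof -
  have G: "profinite_graph \<Gamma>" and D: "profinite_graph \<Delta>"
    and sys: "locally_bijective_system I leq \<Gamma>s \<Delta>s fs \<phi>s \<psi>s"
    and LG: "is_inverse_limit \<Gamma> I leq \<Gamma>s \<phi>s \<phi>" and LD: "is_inverse_limit \<Delta> I leq \<Delta>s \<psi>s \<psi>"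
    and sq: "\<And>i x. i \<in> I \<Longrightarrow> x \<in> points \<Gamma> \<Longrightarrow> \<psi> i (f x) = fs i (\<phi> i x)"
    using assms(1) unfolding covering_limit_def by auto
  have ptG: "points \<Gamma> = UNIV" and ptD: "points \<Delta> = UNIV"
    using G D unfolding profinite_graph_def cofinite_graph_def by auto
  have S: "profinite_graph \<Sigma>"
    and conn: "\<And>R. compatible_cofinite_entourage \<Sigma> R \<Longrightarrow> graph_path_connected (quotient_graph \<Sigma> R)"
    using assms(3) unfolding connected_profinite_graph_def by auto
  have grS: "is_graph \<Sigma>" and ptS: "points \<Sigma> = UNIV"
    using S unfolding profinite_graph_def cofinite_graph_def by auto
  have Gs: "is_graph (\<Gamma>s i)" "finite (points (\<Gamma>s i))" and Ds: "is_graph (\<Delta>s i)"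
    and fs: "locally_bijective (\<Gamma>s i) (\<Delta>s i) (fs i)" if "i \<in> I" for i
    using sys that unfolding locally_bijective_system_def inverse_system_def by auto
  have bond: "graph_map (\<Gamma>s j) (\<Gamma>s i) (\<phi>s i j)" if "i \<in> I" "j \<in> I" "leq i j" for i j
    using sys that unfolding locally_bijective_system_def inverse_system_def by auto
  have ne: "I \<noteq> {}"
    using sys unfolding locally_bijective_system_def inverse_system_def directed_def by auto
  have pG: "graph_map \<Gamma> (\<Gamma>s i) (\<phi> i)" and pD: "graph_map \<Delta> (\<Delta>s i) (\<psi> i)" if "i \<in> I" for i
    using LG LD that unfolding is_inverse_limit_def by auto
  have threads: "\<phi>s i j (\<phi> j x) = \<phi> i x" "\<psi>s i j (\<psi> j y) = \<psi> i y"
    if "i \<in> I" "j \<in> I" "leq i j" for i j x y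
  proof -
    \<comment> \<open>Compatibility of the projections with the bonding maps is read off from the
      codomain of the homeomorphism.\<close>
    have "(\<lambda>i\<in>I. \<phi> i x) \<in> threads I leq \<Gamma>s \<phi>s" "(\<lambda>i\<in>I. \<psi> i y) \<in> threads I leq \<Delta>s \<psi>s"
      using LG LD ptG ptD
      unfolding is_inverse_limit_def homeomorphic_map_maps homeomorphic_maps_def continuous_map_def
      by auto
    then show "\<phi>s i j (\<phi> j x) = \<phi> i x" "\<psi>s i j (\<psi> j y) = \<psi> i y"
      using that unfolding threads_def by auto
  qed
  have kg: "graph_map \<Sigma> (\<Delta>s i) (\<lambda>x. \<psi> i (g x))" if "i \<in> I" for i
    using graph_map_comp[OF assms(4) pD[OF that]] by (simp add: comp_def)
  have base: "fs i (\<phi> i a) = \<psi> i b" if "i \<in> I" for i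
    using sq[OF that, of a] ptG assms(9) by simp
  let ?lift = "\<lambda>h. graph_map \<Sigma> \<Gamma> h \<and> continuous_on UNIV h \<and> h c = a \<and> f \<circ> h = g"
  \<comment> \<open>Stagewise data of a lift, used both to find \<open>T\<close> in the forward
    direction and to prove uniqueness in the converse.\<close>
  have lift_stage: "graph_map \<Sigma> (\<Gamma>s i) (\<lambda>x. \<phi> i (h x))"
    "compatible_cofinite_entourage \<Sigma> {(x, y). \<phi> i (h x) = \<phi> i (h y)}"
    "fs i (\<phi> i (h x)) = \<psi> i (g x)"
    if h: "?lift h" and i: "i \<in> I" for h i x
  proof -
    show gm: "graph_map \<Sigma> (\<Gamma>s i) (\<lambda>x. \<phi> i (h x))"
      using graph_map_comp[OF _ pG[OF i]] h by (auto simp: comp_def)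
    have "open (h -` (\<phi> i -` {z}))" for z
      using h inverse_limit_open_vimage[OF LG ptG i] by (auto intro: open_vimage)
    then have "open ((\<lambda>x. \<phi> i (h x)) -` {z})" for z by (simp add: vimage_def)
    then show "compatible_cofinite_entourage \<Sigma> {(x, y). \<phi> i (h x) = \<phi> i (h y)}"
      using compatible_cofinite_entourage_kernel[OF S Gs[OF i] gm] by blast
    show "fs i (\<phi> i (h x)) = \<psi> i (g x)" using h sq[OF i, of "h x"] ptG by auto
  qed
  show ?thesis
  proof (intro iffI ballI)
    fix i assume "\<exists>!h. ?lift h" and i: "i \<in> I"
    then obtain h where h: "?lift h" by blast
    let ?k = "\<lambda>x. \<phi> i (h x)" and ?T = "{(x, y). \<phi> i (h x) = \<phi> i (h y)}"
    let ?Q = "quotient_graph \<Sigma> ?T" and ?w = "?T `` {c}"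
    note T = lift_stage(2)[OF h i]
    have cT: "compatible \<Sigma> ?T" using T unfolding compatible_cofinite_entourage_def by blast
    note k = graph_map_class_map[OF grS cT lift_stage(1)[OF h i]]
    \<comment> \<open>The map to the stage of \<Delta> is \<open>fs i\<close> after
      \<open>?k\<close>, so it is constant wherever \<open>?k\<close> is.\<close>
    have gT: "\<psi> i (g x) = \<psi> i (g y)" if "(x, y) \<in> ?T" for x y
      using that lift_stage(3)[OF h i] by (metis (mono_tags, lifting) case_prodD mem_Collect_eq)
    note K = graph_map_class_map[OF grS cT kg[OF i] gT]
    note cm = class_map_class[OF compatibleD(1)[OF cT], unfolded ptS, OF UNIV_I]
    have cmk: "class_map ?k (?T `` {x}) = ?k x" for x by (rule cm) auto
    have cmg: "class_map (\<lambda>x. \<psi> i (g x)) (?T `` {x}) = \<psi> i (g x)" for x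
      by (rule cm) (use gT in metis)
    \<comment> \<open>The natural map on the quotient factors through \<open>fs i\<close>, which
      forces the inclusion of images. Edges suffice because loops are lists of edges.\<close>
    have factor: "class_map (\<lambda>x. \<psi> i (g x)) C = fs i (class_map ?k C)" if C: "C \<in> edges ?Q" for C
    proof -
      obtain e where "C = ?T `` {e}" using quotient_graph_cases(2)[OF C] by blast
      then show ?thesis using cmk[of e] cmg[of e] lift_stage(3)[OF h i, of e] by simp
    qed
    have "pi1_map (\<Delta>s i) (\<psi> i b) (class_map (\<lambda>x. \<psi> i (g x))) ` carrier (pi1 ?Q ?w)
        \<subseteq> pi1_map (\<Delta>s i) (\<psi> i b) (fs i) ` carrier (pi1 (\<Gamma>s i) (\<phi> i a))"
    proof (rule image_subsetI)
      fix A assume A: "A \<in> carrier (pi1 ?Q ?w)"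
      obtain L where L: "L \<in> loops ?Q ?w" "A = homotopy ?Q ?w `` {L}"
        using A by (auto simp: pi1_def quotient_def)
      \<comment> \<open>The loop in the stage of \<Gamma> whose image under \<open>fs i\<close> is
        the image of \<open>L\<close>.\<close>
      let ?M = "map (class_map ?k) L"
      have w: "class_map ?k ?w = \<phi> i a" "class_map (\<lambda>x. \<psi> i (g x)) ?w = \<psi> i b"
        using cmk[of c] cmg[of c] h assms(10) by auto
      have M: "?M \<in> loops (\<Gamma>s i) (\<phi> i a)"
        using edge_path_map[OF k, of ?w L ?w] L(1) w by (simp add: loops_def)
      have "set L \<subseteq> edges ?Q" using L(1) edge_path_edges by (metis loops_def mem_Collect_eq)
      then have Leq: "map (class_map (\<lambda>x. \<psi> i (g x))) L = map (fs i) ?M"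
        using factor by auto
      have "pi1_map (\<Delta>s i) (\<psi> i b) (class_map (\<lambda>x. \<psi> i (g x))) A
          = pi1_map (\<Delta>s i) (\<psi> i b) (fs i) (homotopy (\<Gamma>s i) (\<phi> i a) `` {?M})"
        using pi1_map_class[OF K L(1)] pi1_map_class[OF locally_bijective_graph_map[OF fs[OF i]] M]
        by (simp only: w base[OF i] L(2) Leq)
      moreover have "homotopy (\<Gamma>s i) (\<phi> i a) `` {?M} \<in> carrier (pi1 (\<Gamma>s i) (\<phi> i a))"
        using M by (auto simp: pi1_def intro: quotientI)
      ultimately show "pi1_map (\<Delta>s i) (\<psi> i b) (class_map (\<lambda>x. \<psi> i (g x))) A
        \<in> pi1_map (\<Delta>s i) (\<psi> i b) (fs i) ` carrier (pi1 (\<Gamma>s i) (\<phi> i a))" by blast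
    qed
    moreover have "map_prod g g ` ?T \<subseteq> {(x, y). \<psi> i x = \<psi> i y}"
    proof (rule image_subsetI)
      fix z assume "z \<in> ?T"
      then show "map_prod g g z \<in> {(x, y). \<psi> i x = \<psi> i y}"
        using gT[of "fst z" "snd z"] by (cases z) simp
    qed
    ultimately show "\<exists>T. compatible_cofinite_entourage \<Sigma> T \<and>
       map_prod g g ` T \<subseteq> {(x, y). \<psi> i x = \<psi> i y} \<and>
       pi1_map (\<Delta>s i) (\<psi> i b) (class_map (\<lambda>x. \<psi> i (g x)))
         ` carrier (pi1 (quotient_graph \<Sigma> T) (T `` {c}))
       \<subseteq> pi1_map (\<Delta>s i) (\<psi> i b) (fs i) ` carrier (pi1 (\<Gamma>s i) (\<phi> i a))"
      using T by (intro exI[of _ ?T] conjI)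
  next
    assume "\<forall>i\<in>I. \<exists>T. compatible_cofinite_entourage \<Sigma> T \<and>
       map_prod g g ` T \<subseteq> {(x, y). \<psi> i x = \<psi> i y} \<and>
       pi1_map (\<Delta>s i) (\<psi> i b) (class_map (\<lambda>x. \<psi> i (g x)))
         ` carrier (pi1 (quotient_graph \<Sigma> T) (T `` {c}))
       \<subseteq> pi1_map (\<Delta>s i) (\<psi> i b) (fs i) ` carrier (pi1 (\<Gamma>s i) (\<phi> i a))"
    then obtain T where T: "\<And>i. i \<in> I \<Longrightarrow> compatible_cofinite_entourage \<Sigma> (T i)"
      and gT': "\<And>i. i \<in> I \<Longrightarrow> map_prod g g ` T i \<subseteq> {(x, y). \<psi> i x = \<psi> i y}"
      and sub: "\<And>i. i \<in> I \<Longrightarrow> pi1_map (\<Delta>s i) (\<psi> i b) (class_map (\<lambda>x. \<psi> i (g x)))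
         ` carrier (pi1 (quotient_graph \<Sigma> (T i)) (T i `` {c}))
       \<subseteq> pi1_map (\<Delta>s i) (\<psi> i b) (fs i) ` carrier (pi1 (\<Gamma>s i) (\<phi> i a))"
      by metis
    have gT: "\<psi> i (g x) = \<psi> i (g y)" if "i \<in> I" "(x, y) \<in> T i" for i x y
      using gT'[OF that(1)] that(2) by force
    have cT: "compatible \<Sigma> (T i)" "entourage (T i)" if "i \<in> I" for i
      using T[OF that] unfolding compatible_cofinite_entourage_def by auto
    have eT: "equiv UNIV (T i)" if "i \<in> I" for i using compatibleD(1)[OF cT(1)[OF that]] ptS by simp
    \<comment> \<open>The lift obtained on the quotient by \<open>T i\<close> is pulled back to
      \<Sigma>. Its constancy on classes is recorded for continuity and for comparing
      stages.\<close>
    have "\<exists>h. graph_map \<Sigma> (\<Gamma>s i) h \<and> h c = \<phi> i a \<and> (\<forall>x. fs i (h x) = \<psi> i (g x)) \<and>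
        (\<forall>x y. (x, y) \<in> T i \<longrightarrow> h x = h y)" if i: "i \<in> I" for i
    proof -
      let ?Q = "quotient_graph \<Sigma> (T i)" and ?K = "class_map (\<lambda>x. \<psi> i (g x))"
      note q = graph_map_quotient[OF cT(1)[OF i]]
      have K: "graph_map ?Q (\<Delta>s i) ?K"
        using graph_map_class_map[OF grS cT(1)[OF i] kg[OF i]] gT[OF i] by blast
      have Kx: "?K (T i `` {x}) = \<psi> i (g x)" for x
        by (rule class_map_class[OF eT[OF i] UNIV_I]) (use gT[OF i] in metis)
      have w: "?K (T i `` {c}) = \<psi> i b" using Kx assms(10) by simp
      obtain H where H: "graph_map ?Q (\<Gamma>s i) H" "H (T i `` {c}) = \<phi> i a"
        "\<And>x. x \<in> points ?Q \<Longrightarrow> fs i (H x) = ?K x"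
        by (rule lifting_criterion[OF fs[OF i] Gs(1)[OF i] Ds[OF i] is_graph_quotient[OF grS cT(1)[OF i]]
            conn[OF T[OF i]] K graph_mapD(1)[OF pG[OF i] assms(6)] graph_mapD(1)[OF q assms(8)]])
          (use w base[OF i] sub[OF i] in auto)
      show ?thesis
      proof (intro exI[of _ "\<lambda>x. H (T i `` {x})"] conjI allI impI)
        show "graph_map \<Sigma> (\<Gamma>s i) (\<lambda>x. H (T i `` {x}))"
          using graph_map_comp[OF q H(1)] by (simp add: comp_def)
        show "fs i (H (T i `` {x})) = \<psi> i (g x)" for x
          using H(3)[OF graph_mapD(6)[OF q]] ptS Kx by simp
        show "H (T i `` {x}) = H (T i `` {y})" if "(x, y) \<in> T i" for x y
          using equiv_class_eq[OF eT[OF i] that] by simp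
      qed (rule H(2))
    qed
    then obtain h where h: "\<And>i. i \<in> I \<Longrightarrow> graph_map \<Sigma> (\<Gamma>s i) (h i)"
      and hc: "\<And>i. i \<in> I \<Longrightarrow> h i c = \<phi> i a"
      and fh: "\<And>i x. i \<in> I \<Longrightarrow> fs i (h i x) = \<psi> i (g x)"
      and hT: "\<And>i x y. i \<in> I \<Longrightarrow> (x, y) \<in> T i \<Longrightarrow> h i x = h i y"
      by metis
    \<comment> \<open>Both sides lift the map from \<Sigma> to stage \<open>i\<close> of \<Delta>,
      agree at \<open>c\<close>, and are constant on the classes of \<open>T i \<inter> T j\<close>,
      whose quotient is path connected.\<close>
    have bonded: "\<phi>s i j (h j x) = h i x" if ij: "i \<in> I" "j \<in> I" "leq i j" for i j x
    proof -
      note R = compatible_cofinite_entourage_Int[OF T[OF ij(1)] T[OF ij(2)]]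
      have cR: "compatible \<Sigma> (T i \<inter> T j)"
        using R unfolding compatible_cofinite_entourage_def by blast
      have hpt: "h j y \<in> points (\<Gamma>s j)" for y using graph_mapD(6)[OF h[OF ij(2)]] ptS by simp
      have comm: "fs i (\<phi>s i j y) = \<psi>s i j (fs j y)" if "y \<in> points (\<Gamma>s j)" for y
        using sys ij that unfolding locally_bijective_system_def by blast
      show ?thesis
      proof (rule lift_unique[OF fs[OF ij(1)] Gs(1)[OF ij(1)] grS cR conn[OF R] _ h[OF ij(1)] _ _ assms(8)])
        show "graph_map \<Sigma> (\<Gamma>s i) (\<lambda>x. \<phi>s i j (h j x))"
          using graph_map_comp[OF h[OF ij(2)] bond[OF ij]] by (simp add: comp_def)
        show "\<phi>s i j (h j x) = \<phi>s i j (h j y) \<and> h i x = h i y" if "(x, y) \<in> T i \<inter> T j" for x y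
          using that hT[OF ij(1), of x y] hT[OF ij(2), of x y] by simp
        show "fs i (\<phi>s i j (h j y)) = fs i (h i y)" for y
          using comm[OF hpt] fh ij threads(2)[OF ij] by simp
        show "\<phi>s i j (h j c) = h i c" using hc ij threads(1)[OF ij] by simp
      qed (simp add: ptS)
    qed
    have op: "open (h i -` Z)" if "i \<in> I" for i Z
      using open_vimage_const_on_classes[OF cT(2)[OF that] eT[OF that] hT[OF that]] .
    obtain H where H: "graph_map \<Sigma> \<Gamma> H" "continuous_on UNIV H" "\<And>i x. i \<in> I \<Longrightarrow> \<phi> i (H x) = h i x"
      by (rule inverse_limit_universal[OF LG ptG ne Gs(1) grS ptS h op bonded]) (assumption | blast intro: that)+
    have "?lift H"
    proof (intro conjI H ext)
      show "H c = a" by (rule inverse_limit_eqI[OF LG ptG]) (simp add: H hc)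
      show "(f \<circ> H) x = g x" for x
        by (rule inverse_limit_eqI[OF LD ptD]) (simp add: sq ptG H fh)
    qed
    \<comment> \<open>At each stage the two composites lift the same map and agree at
      \<open>c\<close>; the intersection of their kernels gives a path connected quotient on which
      they can be compared.\<close>
    moreover have "h1 = h2" if h1: "?lift h1" and h2: "?lift h2" for h1 h2
    proof (intro ext inverse_limit_eqI[OF LG ptG])
      fix x i assume i: "i \<in> I"
      note R = compatible_cofinite_entourage_Int[OF lift_stage(2)[OF h1 i] lift_stage(2)[OF h2 i]]
      then have cR: "compatible \<Sigma> ({(x, y). \<phi> i (h1 x) = \<phi> i (h1 y)} \<inter> {(x, y). \<phi> i (h2 x) = \<phi> i (h2 y)})"
        unfolding compatible_cofinite_entourage_def by blast
      show "\<phi> i (h1 x) = \<phi> i (h2 x)"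
        by (rule lift_unique[OF fs[OF i] Gs(1)[OF i] grS cR conn[OF R]
              lift_stage(1)[OF h1 i] lift_stage(1)[OF h2 i] _ _ assms(8)])
          (use lift_stage(3)[OF h1 i] lift_stage(3)[OF h2 i] h1 h2 ptS in auto)
    qed
    ultimately show "\<exists>!h. ?lift h" by blast
  qed
qed

end
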